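(* For every natural number $n\ge 1$ there exist real square matrices $F$ and $H$ of order $2(n-1)$ such that the matrix pencil $F+\alpha H$ has $n$ disconnected stable regions with respect to the real parameter $\alpha$.
   Context: A square matrix is called stable if all of its eigenvalues have strictly negative real part. For real square matrices $F,H$ of the same order, the stability region (synchronized region) of the pencil $F+\alpha H$ is the set $S=\{\alpha\in\mathbb{R}:\ \alpha<0,\ F+\alpha H \text{ is stable}\}$. The pencil is said to have $k$ disconnected stable regions with respect to $\alpha$ if $S$ consists of $k$ connected components (maximal intervals). For $n=1$ the matrices are the empty $0\times 0$ matrices, which are regarded as stable. *)

theory Defs
  imports "HOL-Analysis.Connected" "Jordan_Normal_Form.Char_Poly"
begin

(* The eigenvalues of a real matrix are its complex ones.  A 0 x 0 matrix has no
   nonzero vector, hence no eigenvalue, and is therefore stable. *)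
definition stable_mat :: "real mat \<Rightarrow> bool" where
  "stable_mat A \<longleftrightarrow> (\<forall>z. eigenvalue (map_mat complex_of_real A) z \<longrightarrow> Re z < 0)"

(* Meaningful for square F and H of the same order. *)
definition stability_region :: "real mat \<Rightarrow> real mat \<Rightarrow> real set" where
  "stability_region F H = {\<alpha>. \<alpha> < 0 \<and> stable_mat (F + \<alpha> \<cdot>\<^sub>m H)}"

(* Finiteness is explicit because card is 0 on infinite sets. *)
definition has_disconnected_stable_regions :: "real mat \<Rightarrow> real mat \<Rightarrow> nat \<Rightarrow> bool" where
  "has_disconnected_stable_regions F H k \<longleftrightarrow>
     finite (components (stability_region F H)) \<and> card (components (stability_region F H)) = k"

end

theory Submission
  imports "HOL-Analysis.Path_Connected" Defs
begin

unbundle no vec_syntax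

text \<open>The \<open>2 \<times> 2\<close> matrix with rows \<open>(-1, 1 - b)\<close> and \<open>(1 + b, -1)\<close> has the eigenvalues
  \<open>-1 \<plusminus> sqrt (1 - b\<^sup>2)\<close>, so it is stable exactly when \<open>b \<noteq> 0\<close>.
  The direct sum of these blocks with \<open>b = \<alpha> + k\<close> for \<open>k = 1, \<dots>, m\<close> is a pencil in \<open>\<alpha>\<close> that is
  stable exactly off \<open>{-1, \<dots>, -m}\<close>, and removing these \<open>m\<close> points cuts the negative half-line
  into \<open>m + 1\<close> intervals.\<close>

text \<open>Block \<open>k\<close> occupies the indices \<open>2 * k\<close> and
  \<open>2 * k + 1\<close>; this involution swaps them, so one row formula serves both rows.\<close>

definition partner :: "nat \<Rightarrow> nat" where
  "partner i = (if even i then i + 1 else i - 1)"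

definition block_sign :: "nat \<Rightarrow> real" where
  "block_sign i = (if even i then -1 else 1)"

text \<open>Counting from 1 keeps every puncture inside the negative half-line; a puncture at 0
  would cut nothing.\<close>

definition block_shift :: "nat \<Rightarrow> real" where
  "block_shift i = real (i div 2 + 1)"

definition pencil_const :: "nat \<Rightarrow> real mat" where
  "pencil_const m = mat (2 * m) (2 * m) (\<lambda>(i, j).
     if j = i then -1 else if j = partner i then 1 + block_sign i * block_shift i else 0)"

definition pencil_slope :: "nat \<Rightarrow> real mat" where
  "pencil_slope m = mat (2 * m) (2 * m) (\<lambda>(i, j). if j = partner i then block_sign i else 0)"

lemma partner_less: "i < 2 * m \<Longrightarrow> partner i < 2 * m"
  unfolding partner_def by presburger

lemma partner_neq: "partner i \<noteq> i"
  unfolding partner_def by presburger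

lemma partner_partner: "partner (partner i) = i"
  unfolding partner_def by auto

lemma partner_div_2: "partner i div 2 = i div 2"
  unfolding partner_def by presburger

lemma block_shift_partner: "block_shift (partner i) = block_shift i"
  by (simp add: block_shift_def partner_div_2)

lemma block_sign_partner: "block_sign (partner i) = - block_sign i"
  by (auto simp: block_sign_def partner_def)

lemma block_sign_mult_self: "block_sign i * block_sign i = 1"
  by (simp add: block_sign_def)

lemma pencil_carrier:
  "pencil_const m \<in> carrier_mat (2 * m) (2 * m)" "pencil_slope m \<in> carrier_mat (2 * m) (2 * m)"
  by (simp_all add: pencil_const_def pencil_slope_def)

lemma pencil_mult_vec:
  fixes v :: "complex vec" and \<alpha> :: real
  assumes v: "v \<in> carrier_vec (2 * m)" and i: "i < 2 * m"
  shows "(map_mat complex_of_real (pencil_const m + \<alpha> \<cdot>\<^sub>m pencil_slope m) *\<^sub>v v) $ i =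
    - (v $ i) + of_real (1 + block_sign i * (\<alpha> + block_shift i)) * v $ partner i"
proof -
  let ?c = "1 + block_sign i * (\<alpha> + block_shift i)"
  have "(map_mat complex_of_real (pencil_const m + \<alpha> \<cdot>\<^sub>m pencil_slope m) *\<^sub>v v) $ i =
    (\<Sum>j = 0..<2 * m. (if j = i then - (v $ j) else 0) +
                    (if j = partner i then of_real ?c * v $ j else 0))"
    \<comment> \<open>As \<open>partner i\<close> differs from \<open>i\<close>, the nested
      conditional splits into two separate indicator terms.\<close>
    using v i partner_neq[of i]
    by (auto simp: scalar_prod_def pencil_const_def pencil_slope_def algebra_simps intro!: sum.cong)
  also have "\<dots> = - (v $ i) + of_real ?c * v $ partner i"
    using i partner_less[OF i] by (simp add: sum.distrib)
  finally show ?thesis .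
qed

text \<open>The imaginary part of the equation makes \<open>z + 1\<close> real or purely imaginary.
  If real, its square is below 1; otherwise \<open>Re z = -1\<close>. This treats small and large
  \<open>b\<close> alike, without square roots.\<close>

lemma Re_neg_if_shifted_square:
  assumes "(z + 1)\<^sup>2 = complex_of_real (1 - b\<^sup>2)" "b \<noteq> 0"
  shows "Re z < 0"
proof -
  have re: "(Re z + 1)\<^sup>2 - (Im z)\<^sup>2 = 1 - b\<^sup>2" and im: "(Re z + 1) * Im z = 0"
    using assms(1) by (auto simp: complex_eq_iff power2_eq_square)
  show ?thesis
  proof (cases "Im z = 0")
    case True
    then have "(Re z + 1)\<^sup>2 < 1\<^sup>2"
      using re assms(2) by simp
    then have "Re z + 1 < 1"
      by (rule power_less_imp_less_base) simp
    then show ?thesis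
      by simp
  next
    case False
    then show ?thesis
      using im by simp
  qed
qed

lemma stable_pencil_iff:
  "stable_mat (pencil_const m + \<alpha> \<cdot>\<^sub>m pencil_slope m) \<longleftrightarrow> (\<forall>k<m. \<alpha> \<noteq> - real (k + 1))"
    (is "stable_mat ?A \<longleftrightarrow> _")
proof
  let ?B = "map_mat complex_of_real ?A"
  have dim: "dim_row ?B = 2 * m"
    by (simp add: pencil_slope_def)
  show "stable_mat ?A" if off: "\<forall>k<m. \<alpha> \<noteq> - real (k + 1)"
    unfolding stable_mat_def
  proof (intro allI impI)
    fix z assume "eigenvalue ?B z"
    then obtain v where v: "v \<in> carrier_vec (2 * m)" "v \<noteq> 0\<^sub>v (2 * m)" "?B *\<^sub>v v = z \<cdot>\<^sub>v v"
      unfolding eigenvalue_def eigenvector_def dim by blast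
    then obtain i where i: "i < 2 * m" "v $ i \<noteq> 0"
      by (metis carrier_vecD eq_vecI index_zero_vec(1) index_zero_vec(2))
    define b where "b = \<alpha> + block_shift i"
    let ?c = "complex_of_real (block_sign i * b)"
    have row: "(z + 1) * v $ j =
        of_real (1 + block_sign j * (\<alpha> + block_shift j)) * v $ partner j" if "j < 2 * m" for j
      using pencil_mult_vec[OF v(1) that, of \<alpha>] v that by (simp add: algebra_simps)
    have "(z + 1) * v $ i = (1 + ?c) * v $ partner i"
      using row[OF i(1)] by (simp add: b_def)
    moreover have "(z + 1) * v $ partner i = (1 - ?c) * v $ i"
      using row[OF partner_less[OF i(1)]]
      by (simp add: b_def block_shift_partner block_sign_partner partner_partner)
    \<comment> \<open>Multiply row \<open>i\<close> by \<open>z + 1\<close> and substitute row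
      \<open>partner i\<close>. The sign then enters only squared, so the parity of \<open>i\<close>
      drops out.\<close>
    ultimately have "(z + 1)\<^sup>2 * v $ i = (1 + ?c) * (1 - ?c) * v $ i"
      by (simp add: power2_eq_square mult.assoc mult.left_commute)
    then have "(z + 1)\<^sup>2 = (1 + ?c) * (1 - ?c)"
      using i(2) by simp
    also have "\<dots> = complex_of_real (1 - (block_sign i * block_sign i) * b\<^sup>2)"
      by (simp add: algebra_simps power2_eq_square)
    finally have "(z + 1)\<^sup>2 = complex_of_real (1 - b\<^sup>2)"
      by (simp add: block_sign_mult_self)
    moreover have "b \<noteq> 0"
      using off i(1) by (auto simp: b_def block_shift_def dest!: spec[of _ "i div 2"])
    ultimately show "Re z < 0"
      by (rule Re_neg_if_shifted_square)
  qed
  show "\<forall>k<m. \<alpha> \<noteq> - real (k + 1)" if stable: "stable_mat ?A"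
  proof (intro allI impI notI)
    fix k assume k: "k < m" and \<alpha>: "\<alpha> = - real (k + 1)"
    \<comment> \<open>At this \<alpha> block \<open>k\<close> has rows \<open>(-1, 1)\<close> and
      \<open>(1, -1)\<close>, which annihilate \<open>(1, 1)\<close>; \<open>v\<close> extends that
      vector by zeros.\<close>
    define v :: "complex vec" where "v = vec (2 * m) (\<lambda>i. if i div 2 = k then 1 else 0)"
    have v: "v \<in> carrier_vec (2 * m)"
      by (simp add: v_def)
    have "?B *\<^sub>v v = 0 \<cdot>\<^sub>v v"
    proof (rule eq_vecI)
      fix i assume "i < dim_vec (0 \<cdot>\<^sub>v v)"
      then have i: "i < 2 * m"
        by (simp add: v_def)
      show "(?B *\<^sub>v v) $ i = (0 \<cdot>\<^sub>v v) $ i"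
        unfolding pencil_mult_vec[OF v i] using i partner_less[OF i]
        by (simp add: v_def partner_div_2 block_shift_def \<alpha>)
    qed (simp add: v_def pencil_slope_def)
    moreover have "v \<noteq> 0\<^sub>v (2 * m)"
    proof
      assume "v = 0\<^sub>v (2 * m)"
      then have "v $ (2 * k) = 0"
        using k by simp
      then show False
        using k by (simp add: v_def)
    qed
    ultimately have "eigenvalue ?B 0"
      using v unfolding eigenvalue_def eigenvector_def dim by blast
    then show False
      using stable unfolding stable_mat_def by fastforce
  qed
qed

text \<open>Disjoint nonempty open connected sets that cover a set are its components. The ray lies
  beyond the last puncture; for \<open>m = 0\<close> it is the whole negative half-line.\<close>

lemma components_punctured_negative_reals:
  "components {x :: real. x < 0 \<and> (\<forall>k<m. x \<noteq> - real (k + 1))} =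
     insert {..<- real m} ((\<lambda>k. {- real (k + 1)<..<- real k}) ` {..<m})"
    (is "components ?S = insert ?U (?I ` _)")
proof (rule components_open_unique)
  have "disjnt (?I k) (?I l)" if "k < l" for k l
    using that by (auto simp: disjnt_iff)
  then have "disjnt (?I k) (?I l)" if "?I k \<noteq> ?I l" for k l
    using that by (metis disjnt_sym nat_neq_iff)
  moreover have "disjnt ?U (?I k)" "disjnt (?I k) ?U" if "k < m" for k
    using that by (auto simp: disjnt_iff)
  ultimately show "pairwise disjnt (insert ?U (?I ` {..<m}))"
    unfolding pairwise_insert pairwise_image by (auto simp: pairwise_def)
  have "?S - ?U \<subseteq> \<Union> (?I ` {..<m})"
  proof
    fix x assume x: "x \<in> ?S - ?U"
    \<comment> \<open>This puts \<open>x\<close> above \<open>- real (k + 1)\<close> and at most at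
      \<open>- real k\<close>. Equality is impossible: \<open>- real k\<close> is 0 or a
      puncture.\<close>
    define k where "k = nat \<lfloor>- x\<rfloor>"
    have k: "real k \<le> - x" "- x < real (k + 1)"
      using x unfolding k_def by (simp_all add: of_nat_nat) linarith+
    have "k \<le> m"
      using k(1) x by simp
    have "x \<noteq> - real k"
    proof
      assume eq: "x = - real k"
      with x obtain l where "k = Suc l"
        by (cases k) auto
      then have "l < m" "x = - real (l + 1)"
        using eq \<open>k \<le> m\<close> by simp_all
      then show False
        using x by blast
    qed
    with k have "x \<in> ?I k"
      by simp
    \<comment> \<open>Off the ray \<open>- x\<close> is at most \<open>m\<close>, and
      \<open>k\<close> is strictly below \<open>- x\<close>.\<close>
    moreover have "k < m"
      using k \<open>x \<noteq> - real k\<close> x by auto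
    ultimately show "x \<in> \<Union> (?I ` {..<m})"
      by (intro UN_I) simp_all
  qed
  moreover have "?U \<subseteq> ?S"
    by auto
  moreover have "\<Union> (?I ` {..<m}) \<subseteq> ?S"
    by auto
  ultimately show "\<Union> (insert ?U (?I ` {..<m})) = ?S"
    unfolding Union_insert by (intro subset_antisym Un_least) (simp_all only: Diff_subset_conv)
  show "open X \<and> connected X \<and> X \<noteq> {}" if "X \<in> insert ?U (?I ` {..<m})" for X
    using that by auto
qed

lemma card_intervals:
  "card (insert {..<- real m} ((\<lambda>k. {- real (k + 1)<..<- real k}) ` {..<m})) = m + 1"
proof -
  let ?I = "\<lambda>k. {- real (k + 1)<..<- real k}"
  have "inj_on ?I {..<m}"
    \<comment> \<open>The supremum of the interval is \<open>- real k\<close>, which recovers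
      \<open>k\<close>.\<close>
    by (rule inj_on_inverseI[of _ "\<lambda>X. nat \<lfloor>- Sup X\<rfloor>"]) simp
  moreover have "{..<- real m} \<noteq> ?I k" for k
  proof -
    \<comment> \<open>The witness is below \<open>- real m\<close> and at or below the excluded left
      end of \<open>?I k\<close>.\<close>
    have "- real m - real (k + 1) \<in> {..<- real m}" "- real m - real (k + 1) \<notin> ?I k"
      by auto
    then show ?thesis
      by metis
  qed
  ultimately show ?thesis
    by (subst card_insert_disjoint) (auto simp: card_image)
qed

theorem theorem1:
  fixes n :: nat
  assumes "n \<ge> 1"
  shows "\<exists>F H :: real mat.
           F \<in> carrier_mat (2 * (n - 1)) (2 * (n - 1)) \<and>
           H \<in> carrier_mat (2 * (n - 1)) (2 * (n - 1)) \<and>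
           has_disconnected_stable_regions F H n"
proof -
  \<comment> \<open>\<open>n - 1\<close> punctures leave \<open>n\<close> pieces; for
    \<open>n = 1\<close> the matrices are empty and only the ray remains.\<close>
  let ?m = "n - 1"
  have "components (stability_region (pencil_const ?m) (pencil_slope ?m)) =
      insert {..<- real ?m} ((\<lambda>k. {- real (k + 1)<..<- real k}) ` {..<?m})"
    unfolding stability_region_def stable_pencil_iff by (rule components_punctured_negative_reals)
  then have "has_disconnected_stable_regions (pencil_const ?m) (pencil_slope ?m) n"
    unfolding has_disconnected_stable_regions_def using assms card_intervals[of ?m] by simp
  then show ?thesis
    using pencil_carrier by blast
qed

end
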